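(* If $S$ is an s-primitive semiring, then there exist a division semiring $D$ and a right $D$-semimodule $M$ such that the opposite semiring $S^{op}$ is isomorphic to a 1-fold transitive subsemiring of the semiring $\mathrm{End}_D(M)$ of all endomorphisms of the $D$-semimodule $M$.
   Context: A semiring $(S,+,\cdot)$ is a set with $(S,+)$ a commutative monoid with identity $0$, $(S,\cdot)$ a semigroup (no multiplicative identity is assumed), multiplication distributing over addition on both sides, and $0s=s0=0$ for all $s$. A division semiring is a semiring with multiplicative identity in which every nonzero element has a multiplicative inverse. The opposite semiring $S^{op}$ is $(S,+,\circ)$ with $a\circ b=b\cdot a$. An $S$-semimodule is a right $S$-semimodule: a commutative monoid $(M,+,0_M)$ with a map $M\times S\to M$ such that $(m_1+m_2)s=m_1s+m_2s$, $m(s_1+s_2)=ms_1+ms_2$, $m(s_1s_2)=(ms_1)s_2$, $m0=0_M=0_Ms$. $M$ is called minimal if $MS\neq 0$ (i.e. $ms\ne 0_M$ for some $m\in M,s\in S$) and its only subsemimodules are $(0)$ and $M$; it is called simple if it is minimal and its only $S$-semimodule congruences are the equality relation and $M\times M$. $M$ is faithful if $\mathrm{ann}_S(M)=\{(s_1,s_2)\in S\times S\mid ms_1=ms_2 \text{ for all } m\in M\}$ equals $\{(s,s)\mid s\in S\}$. $S$ is (right) s-primitive if there is a faithful simple (right) $S$-semimodule. $\mathrm{End}_D(M)$ is a semiring under pointwise addition and composition $(\alpha\beta)(m)=\alpha(\beta(m))$. A subsemiring $T$ of $\mathrm{End}_D(M)$ is 1-fold transitive if for every nonzero $m\in M$ and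 every $n\in M$ there exists $\alpha\in T$ with $\alpha(m)=n$. *)

theory Defs
  imports "HOL-Algebra.Ring" "HOL-Library.FuncSet"
begin

section \<open>Semirings\<close>

text \<open>
  The locale \<open>semiring\<close> of HOL-Algebra has a multiplicative identity, so semirings without one get
  a locale of their own. It is formulated over the usual ring record, whose field \<open>one\<close> is
  ignored: no axiom mentions it, and neither do the isomorphisms and subsemirings below.
\<close>

locale nonunital_semiring = abelian_monoid S for S (structure) +
  assumes m_closed: "\<lbrakk>a \<in> carrier S; b \<in> carrier S\<rbrakk> \<Longrightarrow> a \<otimes> b \<in> carrier S"
    and m_assoc: "\<lbrakk>a \<in> carrier S; b \<in> carrier S; c \<in> carrier S\<rbrakk> \<Longrightarrow> (a \<otimes> b) \<otimes> c = a \<otimes> (b \<otimes> c)"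
    and l_distr: "\<lbrakk>a \<in> carrier S; b \<in> carrier S; c \<in> carrier S\<rbrakk> \<Longrightarrow> (a \<oplus> b) \<otimes> c = a \<otimes> c \<oplus> b \<otimes> c"
    and r_distr: "\<lbrakk>a \<in> carrier S; b \<in> carrier S; c \<in> carrier S\<rbrakk> \<Longrightarrow> c \<otimes> (a \<oplus> b) = c \<otimes> a \<oplus> c \<otimes> b"
    and l_null: "a \<in> carrier S \<Longrightarrow> \<zero> \<otimes> a = \<zero>"
    and r_null: "a \<in> carrier S \<Longrightarrow> a \<otimes> \<zero> = \<zero>"

text \<open>The axioms do not exclude the zero semiring, in which the identity is zero.\<close>

locale division_semiring = semiring D for D (structure) +
  assumes nonzero_Units: "carrier D - {\<zero>} \<subseteq> Units D"

definition opposite_semiring :: "('s, 'x) ring_scheme \<Rightarrow> ('s, 'x) ring_scheme"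
  where "opposite_semiring S = S\<lparr>mult := \<lambda>a b. b \<otimes>\<^bsub>S\<^esub> a\<rparr>"

definition subsemiring :: "'a set \<Rightarrow> ('a, 'x) ring_scheme \<Rightarrow> bool"
  where "subsemiring T R \<longleftrightarrow> T \<subseteq> carrier R \<and> \<zero>\<^bsub>R\<^esub> \<in> T \<and>
    (\<forall>a\<in>T. \<forall>b\<in>T. a \<oplus>\<^bsub>R\<^esub> b \<in> T \<and> a \<otimes>\<^bsub>R\<^esub> b \<in> T)"

definition semiring_isomorphic :: "('a, 'x) ring_scheme \<Rightarrow> ('b, 'y) ring_scheme \<Rightarrow> bool"
  where "semiring_isomorphic R R' \<longleftrightarrow> (\<exists>h. bij_betw h (carrier R) (carrier R') \<and> h \<zero>\<^bsub>R\<^esub> = \<zero>\<^bsub>R'\<^esub> \<and>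
    (\<forall>a\<in>carrier R. \<forall>b\<in>carrier R.
      h (a \<oplus>\<^bsub>R\<^esub> b) = h a \<oplus>\<^bsub>R'\<^esub> h b \<and> h (a \<otimes>\<^bsub>R\<^esub> b) = h a \<otimes>\<^bsub>R'\<^esub> h b))"


section \<open>Right semimodules\<close>

text \<open>As in the library's \<open>module\<close> record, the fields \<open>mult\<close> and \<open>one\<close> are not used.
  The action is not required to be unital, even when the semiring has an identity.\<close>

record ('s, 'm) right_semimodule = "'m ring" +
  rsmult :: "['m, 's] \<Rightarrow> 'm" (infixl \<open>\<odot>\<index>\<close> 70)

locale right_semimodule = S?: nonunital_semiring S + M?: abelian_monoid M
  for S (structure) and M (structure) +
  assumes rsmult_closed: "\<lbrakk>m \<in> carrier M; s \<in> carrier S\<rbrakk> \<Longrightarrow> m \<odot>\<^bsub>M\<^esub> s \<in> carrier M"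
    and rsmult_l_distr: "\<lbrakk>m \<in> carrier M; n \<in> carrier M; s \<in> carrier S\<rbrakk> \<Longrightarrow>
      (m \<oplus>\<^bsub>M\<^esub> n) \<odot>\<^bsub>M\<^esub> s = m \<odot>\<^bsub>M\<^esub> s \<oplus>\<^bsub>M\<^esub> n \<odot>\<^bsub>M\<^esub> s"
    and rsmult_r_distr: "\<lbrakk>m \<in> carrier M; s \<in> carrier S; t \<in> carrier S\<rbrakk> \<Longrightarrow>
      m \<odot>\<^bsub>M\<^esub> (s \<oplus>\<^bsub>S\<^esub> t) = m \<odot>\<^bsub>M\<^esub> s \<oplus>\<^bsub>M\<^esub> m \<odot>\<^bsub>M\<^esub> t"
    and rsmult_assoc: "\<lbrakk>m \<in> carrier M; s \<in> carrier S; t \<in> carrier S\<rbrakk> \<Longrightarrow>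
      m \<odot>\<^bsub>M\<^esub> (s \<otimes>\<^bsub>S\<^esub> t) = (m \<odot>\<^bsub>M\<^esub> s) \<odot>\<^bsub>M\<^esub> t"
    and rsmult_r_null: "m \<in> carrier M \<Longrightarrow> m \<odot>\<^bsub>M\<^esub> \<zero>\<^bsub>S\<^esub> = \<zero>\<^bsub>M\<^esub>"
    and rsmult_l_null: "s \<in> carrier S \<Longrightarrow> \<zero>\<^bsub>M\<^esub> \<odot>\<^bsub>M\<^esub> s = \<zero>\<^bsub>M\<^esub>"

definition subsemimodule ::
  "'m set \<Rightarrow> ('s, 'x) ring_scheme \<Rightarrow> ('s, 'm, 'y) right_semimodule_scheme \<Rightarrow> bool"
  where "subsemimodule N S M \<longleftrightarrow> N \<subseteq> carrier M \<and> \<zero>\<^bsub>M\<^esub> \<in> N \<and>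
    (\<forall>m\<in>N. \<forall>n\<in>N. m \<oplus>\<^bsub>M\<^esub> n \<in> N) \<and> (\<forall>m\<in>N. \<forall>s\<in>carrier S. m \<odot>\<^bsub>M\<^esub> s \<in> N)"

definition semimodule_congruence ::
  "('m \<times> 'm) set \<Rightarrow> ('s, 'x) ring_scheme \<Rightarrow> ('s, 'm, 'y) right_semimodule_scheme \<Rightarrow> bool"
  where "semimodule_congruence r S M \<longleftrightarrow> equiv (carrier M) r \<and>
    (\<forall>(m, m')\<in>r. \<forall>(n, n')\<in>r. (m \<oplus>\<^bsub>M\<^esub> n, m' \<oplus>\<^bsub>M\<^esub> n') \<in> r) \<and>
    (\<forall>(m, m')\<in>r. \<forall>s\<in>carrier S. (m \<odot>\<^bsub>M\<^esub> s, m' \<odot>\<^bsub>M\<^esub> s) \<in> r)"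

definition minimal_semimodule ::
  "('s, 'x) ring_scheme \<Rightarrow> ('s, 'm, 'y) right_semimodule_scheme \<Rightarrow> bool"
  where "minimal_semimodule S M \<longleftrightarrow> right_semimodule S M \<and>
    (\<exists>m\<in>carrier M. \<exists>s\<in>carrier S. m \<odot>\<^bsub>M\<^esub> s \<noteq> \<zero>\<^bsub>M\<^esub>) \<and>
    (\<forall>N. subsemimodule N S M \<longrightarrow> N = {\<zero>\<^bsub>M\<^esub>} \<or> N = carrier M)"

definition simple_semimodule ::
  "('s, 'x) ring_scheme \<Rightarrow> ('s, 'm, 'y) right_semimodule_scheme \<Rightarrow> bool"
  where "simple_semimodule S M \<longleftrightarrow> minimal_semimodule S M \<and>
    (\<forall>r. semimodule_congruence r S M \<longrightarrow> r = Id_on (carrier M) \<or> r = carrier M \<times> carrier M)"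

definition semimodule_annihilator ::
  "('s, 'x) ring_scheme \<Rightarrow> ('s, 'm, 'y) right_semimodule_scheme \<Rightarrow> ('s \<times> 's) set"
  where "semimodule_annihilator S M =
    {(s, t) \<in> carrier S \<times> carrier S. \<forall>m\<in>carrier M. m \<odot>\<^bsub>M\<^esub> s = m \<odot>\<^bsub>M\<^esub> t}"

definition faithful_semimodule ::
  "('s, 'x) ring_scheme \<Rightarrow> ('s, 'm, 'y) right_semimodule_scheme \<Rightarrow> bool"
  where "faithful_semimodule S M \<longleftrightarrow>
    right_semimodule S M \<and> semimodule_annihilator S M = Id_on (carrier S)"

text \<open>
  HOL cannot quantify existentially over the type of the elements of the semimodule, so that type
  is an argument. In a theorem with \<open>s_primitive TYPE('m) S\<close> as an assumption and \<open>'m\<close> a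
  type variable, the faithful simple semimodule may live on any type whatsoever.
\<close>

definition s_primitive :: "'m itself \<Rightarrow> ('s, 'x) ring_scheme \<Rightarrow> bool"
  where "s_primitive (_ :: 'm itself) S \<longleftrightarrow> nonunital_semiring S \<and>
    (\<exists>M :: ('s, 'm) right_semimodule. simple_semimodule S M \<and> faithful_semimodule S M)"


section \<open>The semiring of endomorphisms of a semimodule\<close>

text \<open>
  Endomorphisms are represented by functions that are \<open>undefined\<close> outside the carrier, so that
  equality of endomorphisms is equality in HOL.
\<close>

definition semimodule_End ::
  "('s, 'x) ring_scheme \<Rightarrow> ('s, 'm, 'y) right_semimodule_scheme \<Rightarrow> ('m \<Rightarrow> 'm) ring"
  where "semimodule_End D M = \<lparr>
    carrier = {f \<in> carrier M \<rightarrow>\<^sub>E carrier M. f \<zero>\<^bsub>M\<^esub> = \<zero>\<^bsub>M\<^esub> \<and>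
      (\<forall>m\<in>carrier M. \<forall>n\<in>carrier M. f (m \<oplus>\<^bsub>M\<^esub> n) = f m \<oplus>\<^bsub>M\<^esub> f n) \<and>
      (\<forall>m\<in>carrier M. \<forall>d\<in>carrier D. f (m \<odot>\<^bsub>M\<^esub> d) = f m \<odot>\<^bsub>M\<^esub> d)},
    mult = (\<lambda>f g. compose (carrier M) f g),
    one = (\<lambda>m\<in>carrier M. m),
    zero = (\<lambda>m\<in>carrier M. \<zero>\<^bsub>M\<^esub>),
    add = (\<lambda>f g. \<lambda>m\<in>carrier M. f m \<oplus>\<^bsub>M\<^esub> g m)\<rparr>"

definition one_fold_transitive :: "('m \<Rightarrow> 'm) set \<Rightarrow> ('m, 'y) ring_scheme \<Rightarrow> bool"
  where "one_fold_transitive T M \<longleftrightarrow>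
    (\<forall>m\<in>carrier M - {\<zero>\<^bsub>M\<^esub>}. \<forall>n\<in>carrier M. \<exists>\<alpha>\<in>T. \<alpha> m = n)"


section \<open>Basic facts\<close>

lemma (in semiring) nonunital_semiring: "nonunital_semiring R"
  by unfold_locales (auto simp: m_assoc l_distr r_distr)

lemma (in nonunital_semiring) nonunital_semiring_opposite:
  "nonunital_semiring (opposite_semiring S)"
proof -
  have "abelian_monoid (opposite_semiring S)"
    by (rule abelian_monoidI) (simp_all add: opposite_semiring_def a_ac)
  then show ?thesis
    unfolding nonunital_semiring_def nonunital_semiring_axioms_def
    by (auto simp: opposite_semiring_def m_closed m_assoc l_distr r_distr l_null r_null)
qed

lemma (in right_semimodule) semiring_End: "semiring (semimodule_End S M)"
proof (rule semiring.intro)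
  show "abelian_monoid (semimodule_End S M)"
    by (rule abelian_monoidI)
      (auto simp: semimodule_End_def PiE_iff fun_eq_iff extensional_def rsmult_closed
        rsmult_l_distr rsmult_l_null M.a_ac)
  show "monoid (semimodule_End S M)"
    by (rule monoidI)
      (auto simp: semimodule_End_def PiE_iff fun_eq_iff extensional_def compose_def rsmult_closed)
  show "semiring_axioms (semimodule_End S M)"
    by unfold_locales
      (auto simp: semimodule_End_def PiE_iff fun_eq_iff extensional_def compose_def)
qed

end

theory Submission
  imports Defs
begin

text \<open>
  The theorem is the semiring version of the classical representation of a primitive ring as a
  transitive ring of linear maps. Let \<open>M\<close> be a faithful simple right \<open>S\<close>-semimodule.

  Schur's lemma: the kernel of an \<open>S\<close>-endomorphism of \<open>M\<close>, understood as the congruence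
  \<open>f m = f n\<close>, is equality or the full relation, and its image is \<open>0\<close> or \<open>M\<close>. Hence a nonzero
  endomorphism is bijective, and the \<open>S\<close>-endomorphisms of \<open>M\<close> form a division semiring
  (\<open>endomorphisms_division_semiring\<close>). Simplicity has to be used in both of its parts: without
  subtraction, a trivial set of zeros does not make an endomorphism injective.

  Endomorphisms compose on the left, whereas \<open>M\<close> is to be a right semimodule, so \<open>D\<close> is the
  opposite of the semiring of \<open>S\<close>-endomorphisms, acting on \<open>M\<close> by evaluation. Each \<open>s\<close> in \<open>S\<close>
  acts on \<open>M\<close> by the translation \<open>m \<mapsto> m s\<close>. That this map is \<open>D\<close>-linear says precisely that the
  elements of \<open>D\<close> are \<open>S\<close>-linear. As \<open>m (s t) = (m s) t\<close>, translation reverses products; it is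
  injective because \<open>M\<close> is faithful, so it embeds the opposite semiring of \<open>S\<close> into the
  \<open>D\<close>-endomorphisms of \<open>M\<close>. Finally, the orbit \<open>m S\<close> of a nonzero \<open>m\<close> is a nonzero
  subsemimodule, hence equal to \<open>M\<close> by minimality (\<open>minimal_semimodule_orbit\<close>). This is
  transitivity.
\<close>

lemma (in semiring) semiring_opposite: "semiring (opposite_semiring R)"
proof (rule semiring.intro)
  interpret op: nonunital_semiring "opposite_semiring R"
    by (rule nonunital_semiring.nonunital_semiring_opposite[OF nonunital_semiring])
  show "abelian_monoid (opposite_semiring R)" ..
  show "Group.monoid (opposite_semiring R)"
    by (rule monoidI) (simp_all add: opposite_semiring_def m_assoc)
  show "semiring_axioms (opposite_semiring R)"
    by unfold_locales
      (use op.l_distr op.r_distr op.l_null op.r_null in auto)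
qed

lemma (in division_semiring) division_semiring_opposite:
  "division_semiring (opposite_semiring D)"
proof -
  have "Units (opposite_semiring D) = Units D"
    by (auto simp: Units_def opposite_semiring_def)
  then show ?thesis
    using nonzero_Units semiring_opposite
    by (simp add: division_semiring_def division_semiring_axioms_def opposite_semiring_def)
qed

text \<open>
  Minimality is used twice: once for the orbit itself, and once for the elements that \<open>S\<close>
  annihilates. The latter form a subsemimodule, and since \<open>M S\<close> is nonzero it must be trivial;
  therefore the orbit of a nonzero element is not zero.
\<close>

lemma minimal_semimodule_orbit:
  assumes "minimal_semimodule S M" and m: "m \<in> carrier M" "m \<noteq> \<zero>\<^bsub>M\<^esub>"
  shows "(\<lambda>s. m \<odot>\<^bsub>M\<^esub> s) ` carrier S = carrier M"
proof -
  interpret right_semimodule S M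
    using assms(1) by (simp add: minimal_semimodule_def)
  have minimal: "N = {\<zero>\<^bsub>M\<^esub>} \<or> N = carrier M" if "subsemimodule N S M" for N
    using assms(1) that by (simp add: minimal_semimodule_def)
  let ?A = "{n \<in> carrier M. \<forall>s\<in>carrier S. n \<odot>\<^bsub>M\<^esub> s = \<zero>\<^bsub>M\<^esub>}"
  have "subsemimodule ?A S M"
    by (auto simp: subsemimodule_def rsmult_l_null rsmult_l_distr rsmult_closed)
  moreover have "?A \<noteq> carrier M"
    using assms(1) by (auto simp: minimal_semimodule_def)
  ultimately have "?A = {\<zero>\<^bsub>M\<^esub>}"
    using minimal by blast
  then obtain s where s: "s \<in> carrier S" "m \<odot>\<^bsub>M\<^esub> s \<noteq> \<zero>\<^bsub>M\<^esub>"
    using m by blast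
  have "subsemimodule ((\<lambda>s. m \<odot>\<^bsub>M\<^esub> s) ` carrier S) S M"
    unfolding subsemimodule_def
  proof (intro conjI ballI)
    show "(\<lambda>s. m \<odot>\<^bsub>M\<^esub> s) ` carrier S \<subseteq> carrier M"
      using m by (auto simp: rsmult_closed)
    show "\<zero>\<^bsub>M\<^esub> \<in> (\<lambda>s. m \<odot>\<^bsub>M\<^esub> s) ` carrier S"
      using rsmult_r_null[OF m(1)] S.zero_closed by (metis imageI)
  next
    fix a b assume "a \<in> (\<lambda>s. m \<odot>\<^bsub>M\<^esub> s) ` carrier S" "b \<in> (\<lambda>s. m \<odot>\<^bsub>M\<^esub> s) ` carrier S"
    then show "a \<oplus>\<^bsub>M\<^esub> b \<in> (\<lambda>s. m \<odot>\<^bsub>M\<^esub> s) ` carrier S"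
      by (auto simp flip: rsmult_r_distr[OF m(1)])
  next
    fix a t assume "a \<in> (\<lambda>s. m \<odot>\<^bsub>M\<^esub> s) ` carrier S" "t \<in> carrier S"
    then show "a \<odot>\<^bsub>M\<^esub> t \<in> (\<lambda>s. m \<odot>\<^bsub>M\<^esub> s) ` carrier S"
      by (auto simp: S.m_closed simp flip: rsmult_assoc[OF m(1)])
  qed
  then show ?thesis
    using minimal s by blast
qed

lemma simple_semimodule_endomorphism_bij:
  assumes simple: "simple_semimodule S M"
    and f: "f \<in> carrier (semimodule_End S M)" "f \<noteq> \<zero>\<^bsub>semimodule_End S M\<^esub>"
  shows "bij_betw f (carrier M) (carrier M)"
proof -
  interpret right_semimodule S M
    using simple by (simp add: simple_semimodule_def minimal_semimodule_def)
  have f_ext: "f \<in> carrier M \<rightarrow>\<^sub>E carrier M"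
    and f_zero: "f \<zero>\<^bsub>M\<^esub> = \<zero>\<^bsub>M\<^esub>"
    and f_add: "\<And>m n. \<lbrakk>m \<in> carrier M; n \<in> carrier M\<rbrakk> \<Longrightarrow> f (m \<oplus>\<^bsub>M\<^esub> n) = f m \<oplus>\<^bsub>M\<^esub> f n"
    and f_smult: "\<And>m s. \<lbrakk>m \<in> carrier M; s \<in> carrier S\<rbrakk> \<Longrightarrow> f (m \<odot>\<^bsub>M\<^esub> s) = f m \<odot>\<^bsub>M\<^esub> s"
    using f(1) by (simp_all add: semimodule_End_def)
  have f_closed: "f m \<in> carrier M" if "m \<in> carrier M" for m
    using f_ext that by auto
  have "\<exists>m\<in>carrier M. f m \<noteq> \<zero>\<^bsub>M\<^esub>"
  proof (rule ccontr)
    assume "\<not> (\<exists>m\<in>carrier M. f m \<noteq> \<zero>\<^bsub>M\<^esub>)"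
    then have "f = (\<lambda>m\<in>carrier M. \<zero>\<^bsub>M\<^esub>)"
      using f_ext by (auto simp: fun_eq_iff PiE_iff extensional_def)
    with f(2) show False
      by (simp add: semimodule_End_def)
  qed
  then obtain m where m: "m \<in> carrier M" "f m \<noteq> \<zero>\<^bsub>M\<^esub>"
    by blast
  let ?K = "{(a, b) \<in> carrier M \<times> carrier M. f a = f b}"
  have "equiv (carrier M) ?K"
    by (rule equivI) (auto simp: refl_on_def sym_def trans_def)
  then have "semimodule_congruence ?K S M"
    by (auto simp: semimodule_congruence_def f_add f_smult rsmult_closed)
  moreover have "(m, \<zero>\<^bsub>M\<^esub>) \<notin> ?K"
    using m f_zero by simp
  ultimately have K: "?K = Id_on (carrier M)"
    using simple m(1) M.zero_closed unfolding simple_semimodule_def by blast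
  have inj: "inj_on f (carrier M)"
  proof (rule inj_onI)
    fix a b assume "a \<in> carrier M" "b \<in> carrier M" "f a = f b"
    then have "(a, b) \<in> ?K"
      by simp
    then show "a = b"
      unfolding K by auto
  qed
  have "subsemimodule (f ` carrier M) S M"
    unfolding subsemimodule_def
  proof (intro conjI ballI)
    show "f ` carrier M \<subseteq> carrier M"
      using f_closed by auto
    show "\<zero>\<^bsub>M\<^esub> \<in> f ` carrier M"
      using f_zero M.zero_closed by (metis imageI)
  next
    fix a b assume "a \<in> f ` carrier M" "b \<in> f ` carrier M"
    then show "a \<oplus>\<^bsub>M\<^esub> b \<in> f ` carrier M"
      by (auto simp: f_add[symmetric])
  next
    fix a s assume "a \<in> f ` carrier M" "s \<in> carrier S"
    then show "a \<odot>\<^bsub>M\<^esub> s \<in> f ` carrier M"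
      by (auto simp: f_smult[symmetric] rsmult_closed)
  qed
  then have "f ` carrier M = {\<zero>\<^bsub>M\<^esub>} \<or> f ` carrier M = carrier M"
    using simple by (simp add: simple_semimodule_def minimal_semimodule_def)
  then have "f ` carrier M = carrier M"
    using m by blast
  with inj show ?thesis
    by (simp add: bij_betw_def)
qed

text \<open>What is left of Schur's lemma is that the inverse map of a bijective endomorphism is again
  an endomorphism; it is linear because \<open>f\<close> is linear and injective.\<close>

lemma endomorphisms_division_semiring:
  assumes simple: "simple_semimodule S M"
  shows "division_semiring (semimodule_End S M)"
proof -
  interpret right_semimodule S M
    using simple by (simp add: simple_semimodule_def minimal_semimodule_def)
  have "f \<in> Units (semimodule_End S M)"
    if f: "f \<in> carrier (semimodule_End S M)" "f \<noteq> \<zero>\<^bsub>semimodule_End S M\<^esub>" for f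
  proof -
    have bij: "bij_betw f (carrier M) (carrier M)"
      by (rule simple_semimodule_endomorphism_bij[OF simple f])
    have f_ext: "f \<in> carrier M \<rightarrow>\<^sub>E carrier M"
      and f_zero: "f \<zero>\<^bsub>M\<^esub> = \<zero>\<^bsub>M\<^esub>"
      and f_add: "\<And>m n. \<lbrakk>m \<in> carrier M; n \<in> carrier M\<rbrakk> \<Longrightarrow> f (m \<oplus>\<^bsub>M\<^esub> n) = f m \<oplus>\<^bsub>M\<^esub> f n"
      and f_smult: "\<And>m s. \<lbrakk>m \<in> carrier M; s \<in> carrier S\<rbrakk> \<Longrightarrow> f (m \<odot>\<^bsub>M\<^esub> s) = f m \<odot>\<^bsub>M\<^esub> s"
      using f(1) by (simp_all add: semimodule_End_def)
    define g where "g = (\<lambda>m\<in>carrier M. inv_into (carrier M) f m)"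
    have g_closed: "g m \<in> carrier M" if "m \<in> carrier M" for m
      using bij that by (auto simp: g_def bij_betw_def inv_into_into)
    have fg: "f (g m) = m" if "m \<in> carrier M" for m
      using bij that by (simp add: g_def bij_betw_inv_into_right)
    have gf: "g (f m) = m" if "m \<in> carrier M" for m
      using bij that f_ext by (auto simp: g_def bij_betw_inv_into_left PiE_iff)
    have "g \<in> carrier (semimodule_End S M)"
    proof -
      have "g \<in> carrier M \<rightarrow>\<^sub>E carrier M"
        using g_closed by (auto simp: PiE_iff g_def)
      moreover have "g \<zero>\<^bsub>M\<^esub> = \<zero>\<^bsub>M\<^esub>"
        using gf[OF M.zero_closed] f_zero by simp
      moreover have "g (m \<oplus>\<^bsub>M\<^esub> n) = g m \<oplus>\<^bsub>M\<^esub> g n" if "m \<in> carrier M" "n \<in> carrier M" for m n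
        using gf[of "g m \<oplus>\<^bsub>M\<^esub> g n"] that by (simp add: f_add g_closed fg)
      moreover have "g (m \<odot>\<^bsub>M\<^esub> s) = g m \<odot>\<^bsub>M\<^esub> s" if "m \<in> carrier M" "s \<in> carrier S" for m s
        using gf[of "g m \<odot>\<^bsub>M\<^esub> s"] that by (simp add: f_smult g_closed fg rsmult_closed)
      ultimately show ?thesis
        by (simp add: semimodule_End_def)
    qed
    moreover have "compose (carrier M) g f = (\<lambda>m\<in>carrier M. m)"
      "compose (carrier M) f g = (\<lambda>m\<in>carrier M. m)"
      using gf fg by (auto simp: compose_def fun_eq_iff)
    ultimately show ?thesis
      using f(1) unfolding Units_def by (auto simp: semimodule_End_def)
  qed
  then show ?thesis
    using semiring_End by (auto simp: division_semiring_def division_semiring_axioms_def)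
qed

definition evaluation_semimodule ::
  "('s, 'm, 'y) right_semimodule_scheme \<Rightarrow> ('m \<Rightarrow> 'm, 'm) right_semimodule"
  where "evaluation_semimodule M = \<lparr>carrier = carrier M, mult = mult M, one = one M,
    zero = zero M, add = add M, rsmult = (\<lambda>m f. f m)\<rparr>"

lemma evaluation_semimodule_simps [simp]:
  "carrier (evaluation_semimodule M) = carrier M"
  "\<zero>\<^bsub>evaluation_semimodule M\<^esub> = \<zero>\<^bsub>M\<^esub>"
  "m \<oplus>\<^bsub>evaluation_semimodule M\<^esub> n = m \<oplus>\<^bsub>M\<^esub> n"
  "m \<odot>\<^bsub>evaluation_semimodule M\<^esub> f = f m"
  by (simp_all add: evaluation_semimodule_def)

lemma (in right_semimodule) right_semimodule_evaluation:
  "right_semimodule (opposite_semiring (semimodule_End S M)) (evaluation_semimodule M)"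
proof -
  interpret E: semiring "semimodule_End S M"
    by (rule semiring_End)
  have "nonunital_semiring (opposite_semiring (semimodule_End S M))"
    by (rule nonunital_semiring.nonunital_semiring_opposite[OF E.nonunital_semiring])
  moreover have "abelian_monoid (evaluation_semimodule M)"
    by (rule abelian_monoidI) (auto simp: M.a_ac)
  ultimately show ?thesis
    by (auto simp: right_semimodule_def right_semimodule_axioms_def opposite_semiring_def
        semimodule_End_def PiE_iff compose_def)
qed

definition right_translation :: "('s, 'm, 'y) right_semimodule_scheme \<Rightarrow> 's \<Rightarrow> 'm \<Rightarrow> 'm"
  where "right_translation M s = (\<lambda>m\<in>carrier M. m \<odot>\<^bsub>M\<^esub> s)"

lemma (in right_semimodule) right_translation_endomorphism:
  assumes "s \<in> carrier S"
  shows "right_translation M s \<in> carrier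
    (semimodule_End (opposite_semiring (semimodule_End S M)) (evaluation_semimodule M))"
  using assms
  by (auto simp: right_translation_def semimodule_End_def opposite_semiring_def PiE_iff
      rsmult_closed rsmult_l_distr rsmult_l_null)

text \<open>The laws of a right action, read as identities of maps on \<open>M\<close>. They do not depend on the
  semiring \<open>D\<close> whose endomorphisms are considered, as \<open>D\<close> enters only the carrier of the
  semiring of endomorphisms.\<close>

lemma (in right_semimodule) right_translation_hom:
  fixes D
  defines "E \<equiv> semimodule_End D (evaluation_semimodule M)"
  shows "right_translation M \<zero>\<^bsub>S\<^esub> = \<zero>\<^bsub>E\<^esub>"
    and "\<lbrakk>s \<in> carrier S; t \<in> carrier S\<rbrakk> \<Longrightarrow>
      right_translation M (s \<oplus>\<^bsub>S\<^esub> t) = right_translation M s \<oplus>\<^bsub>E\<^esub> right_translation M t"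
    and "\<lbrakk>s \<in> carrier S; t \<in> carrier S\<rbrakk> \<Longrightarrow>
      right_translation M (t \<otimes>\<^bsub>S\<^esub> s) = right_translation M s \<otimes>\<^bsub>E\<^esub> right_translation M t"
  by (auto simp: E_def right_translation_def semimodule_End_def fun_eq_iff compose_def
      rsmult_r_null rsmult_r_distr rsmult_assoc rsmult_closed)

lemma faithful_semimodule_inj_right_translation:
  assumes "faithful_semimodule S M"
  shows "inj_on (right_translation M) (carrier S)"
proof (rule inj_onI)
  fix s t
  assume st: "s \<in> carrier S" "t \<in> carrier S" "right_translation M s = right_translation M t"
  then have "m \<odot>\<^bsub>M\<^esub> s = m \<odot>\<^bsub>M\<^esub> t" if "m \<in> carrier M" for m
    using that by (metis restrict_apply' right_translation_def)
  then have "(s, t) \<in> semimodule_annihilator S M"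
    using st by (simp add: semimodule_annihilator_def)
  then show "s = t"
    using assms by (auto simp: faithful_semimodule_def)
qed

theorem theorem4p10:
  fixes S :: "('s, 'x) ring_scheme"
  assumes "s_primitive TYPE('m) S"
  shows "\<exists>(D :: ('m \<Rightarrow> 'm) ring) (M :: ('m \<Rightarrow> 'm, 'm) right_semimodule) T.
    division_semiring D \<and> right_semimodule D M \<and>
    subsemiring T (semimodule_End D M) \<and> one_fold_transitive T M \<and>
    semiring_isomorphic (opposite_semiring S) ((semimodule_End D M)\<lparr>carrier := T\<rparr>)"
proof -
  obtain M :: "('s, 'm) right_semimodule"
    where simple: "simple_semimodule S M" and faithful: "faithful_semimodule S M"
    using assms by (auto simp: s_primitive_def)
  interpret right_semimodule S M
    using faithful by (simp add: faithful_semimodule_def)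
  define D where "D = opposite_semiring (semimodule_End S M)"
  define V where "V = evaluation_semimodule M"
  define T where "T = right_translation M ` carrier S"
  have "division_semiring D"
    unfolding D_def
    by (rule division_semiring.division_semiring_opposite
        [OF endomorphisms_division_semiring[OF simple]])
  moreover have "right_semimodule D V"
    unfolding D_def V_def by (rule right_semimodule_evaluation)
  moreover have "subsemiring T (semimodule_End D V)"
    unfolding subsemiring_def
  proof (intro conjI ballI)
    show "T \<subseteq> carrier (semimodule_End D V)"
      unfolding T_def D_def V_def using right_translation_endomorphism by blast
    show "\<zero>\<^bsub>semimodule_End D V\<^esub> \<in> T"
      unfolding T_def V_def by (simp flip: right_translation_hom(1))
  next
    fix a b assume "a \<in> T" "b \<in> T"
    then show "a \<oplus>\<^bsub>semimodule_End D V\<^esub> b \<in> T" "a \<otimes>\<^bsub>semimodule_End D V\<^esub> b \<in> T"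
      unfolding T_def V_def
      by (auto simp: S.m_closed simp flip: right_translation_hom)
  qed
  moreover have "one_fold_transitive T V"
  proof -
    have "\<exists>\<alpha>\<in>T. \<alpha> m = n"
      if m: "m \<in> carrier M" "m \<noteq> \<zero>\<^bsub>M\<^esub>" and n: "n \<in> carrier M" for m n
    proof -
      have "minimal_semimodule S M"
        using simple by (simp add: simple_semimodule_def)
      from minimal_semimodule_orbit[OF this m] n
      obtain s where "s \<in> carrier S" "n = m \<odot>\<^bsub>M\<^esub> s"
        by blast
      then show ?thesis
        using m by (auto simp: T_def right_translation_def)
    qed
    then show ?thesis
      by (auto simp: one_fold_transitive_def V_def)
  qed
  moreover have "semiring_isomorphic (opposite_semiring S) ((semimodule_End D V)\<lparr>carrier := T\<rparr>)"
    unfolding semiring_isomorphic_def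
    using faithful_semimodule_inj_right_translation[OF faithful]
    by (intro exI[of _ "right_translation M"])
      (auto simp: opposite_semiring_def T_def V_def bij_betw_def
        right_translation_hom[where D = D])
  ultimately show ?thesis
    by blast
qed

end
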